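(* In the setting described in the context, let $\varepsilon>0$ and $i\geqslant1$. Suppose that $u_{j-1}\neq u$ for $1\leqslant j\leqslant i$, and that for each $1\leqslant j\leqslant i$ the widths $\mathbf{n}^{(j)}$ and parameter bounds are chosen so that the basis function $\varphi_j^{NN}$ satisfies $|||\varphi_j-\varphi_j^{NN}|||\leqslant\varepsilon$, where $\varphi_j=(u-u_{j-1})/|||u-u_{j-1}|||$. Then the Galerkin approximation $u_i$ satisfies $$|||u-u_i|||\leqslant|||u-u_0|||\cdot\min\{1,\varepsilon\}^i.$$ Moreover, if $\varepsilon<1$, then $\varphi_i^{NN}$ satisfies $$\langle r(u_{i-1}),\varphi_i^{NN}\rangle\leqslant|||u-u_{i-1}|||\leqslant\frac{1}{1-\varepsilon}\langle r(u_{i-1}),\varphi_i^{NN}\rangle.$$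
   Context: **Variational problem.** $\mathcal{X}$ is a real Hilbert space of functions on a domain $\Omega\subset\mathbb{R}^d$. $a_{LS}:\mathcal{X}\times\mathcal{X}\to\mathbb{R}$ is a symmetric, continuous, coercive bilinear form, with energy norm $|||v|||=a_{LS}(v,v)^{1/2}$. $F_{LS}$ is a continuous linear form on $\mathcal{X}$. $u\in\mathcal{X}$ is the unique solution of $a_{LS}(u,v)=F_{LS}(v)$ for all $v\in\mathcal{X}$. For $w\in\mathcal{X}$, the weak residual is $\langle r(w),v\rangle=F_{LS}(v)-a_{LS}(w,v)$. **Neural network sets.** For an activation function $\sigma$ (applied componentwise), $L\in\mathbb{N}$ and $\mathbf{n}=(n_1,\dots,n_L)\in\mathbb{N}^L$, with $n_0=d$ and $x\in\mathbb{R}^{1\times d}$ a row vector, $V_{\mathbf{n},L}^\sigma$ is the set of $v\in\mathcal{X}$ of the form $v(x)=(\sigma\circ\mathbf{T}_L\circ\cdots\circ\sigma\circ\mathbf{T}_1(x))\cdot\mathbf{c}$, where $\mathbf{T}_j(t)=t\cdot\mathbf{W}^{(j)}+\mathbf{b}^{(j)}$, $\mathbf{W}^{(j)}\in\mathbb{R}^{n_{j-1}\times n_j}$, $\mathbf{b}^{(j)}\in\mathbb{R}^{1\times n_j}$, $\mathbf{c}\in\mathbb{R}^{n_L\times1}$. For $C>0$, $V_{\mathbf{n},L}^{\sigma,C}$ is the subset of those $v$ having such a representation with $\sum_{j=1}^L(\|\mathbf{W}^{(j)}\|_\infty+\|\mathbf{b}^{(j)}\|_\infty)+\|\mathbf{c}\|_\infty\leqslant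 C$. **Knowledge-based sets.** $\Psi:\Omega\times\mathbb{R}\to\mathbb{R}$ is a given function, $\mathcal{M}\in\mathbb{N}$, and $\lambda\in\mathbb{R}^{\mathcal{M}}$ is fixed with $\Psi(\cdot;\lambda_j)\in\mathcal{X}$ for each $j$. $V_{\mathcal{M}}^\Psi(\lambda)=\{\sum_{j=1}^{\mathcal{M}}d_j\Psi(\cdot;\lambda_j):\mathbf{d}\in\mathbb{R}^{\mathcal{M}}\}$. For $C>0$, $V_{\mathcal{M}}^{\Psi,C}(\lambda)$ is the subset of those functions having such a representation with $\|\mathbf{d}\|_\infty+\|\lambda\|_\infty\leqslant C$. $\oplus$ between sets of functions denotes the set of sums. **Iterates.** The initial approximation is $u_0=u_{\sigma,0}+u_{\Psi,0}$ with $u_{\sigma,0}\in\mathcal{X}$ and $u_{\Psi,0}\in V_{\mathcal{M}}^\Psi(\lambda)$. For $j\geqslant1$, given $u_{j-1}\neq u$, the basis function $\varphi_j^{NN}=\varphi_{\sigma,j}^{NN}+\varphi_{\Psi,j}^{NN}$, with $\varphi_{\sigma,j}^{NN}\in V_{\mathbf{n}^{(j)},L_j}^{\sigma,C_1}$ and $\varphi_{\Psi,j}^{NN}\in V_{\mathcal{M}}^{\Psi,C_2}(\lambda)$, is a maximizer of $\langle r(u_{j-1}),v\rangle$ over all $v\in V_{\mathbf{n}^{(j)},L_j}^{\sigma,C_1}\oplus V_{\mathcal{M}}^{\Psi,C_2}(\lambda)$ with $|||v|||=1$ (the widths, depth and constants $C_1,C_2$ may depend on $j$). Then $u_j\in S_j^\Psi:=\mathrm{span}\{u_{\sigma,0},u_{\Psi,0},\varphi_{\sigma,1}^{NN},\varphi_{\Psi,1}^{NN},\dots,\varphi_{\sigma,j}^{NN},\varphi_{\Psi,j}^{NN}\}$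 is defined by $a_{LS}(u_j,v)=F_{LS}(v)$ for all $v\in S_j^\Psi$. *)

theory Defs
  imports "HOL-Analysis.Analysis" "Jordan_Normal_Form.Matrix"
begin

text \<open>
  A real Hilbert space of functions on a domain \<open>\<Omega>\<close>. The Hilbert space is the type \<open>'h\<close>, and
  \<open>rep v f\<close> says that the element \<open>v\<close> is the function \<open>f\<close> on \<open>\<Omega>\<close> (values of \<open>f\<close> off \<open>\<Omega>\<close> are
  irrelevant). A relation is used in place of an evaluation map so that two cases are covered:
  genuine functions (\<open>rep v f\<close> and \<open>rep v g\<close> only if \<open>f = g\<close> on \<open>\<Omega>\<close>) and Lebesgue or Sobolev
  spaces, whose elements have several representatives, equal almost everywhere. Thus
  \<open>\<exists>v. rep v f\<close> expresses that the function \<open>f\<close> belongs to the space.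
\<close>
locale function_hilbert_space =
  fixes \<Omega> :: "(real ^ 'd) set"
    and rep :: "'h::{real_inner, complete_space} \<Rightarrow> (real ^ 'd \<Rightarrow> real) \<Rightarrow> bool"
  assumes domain: "open \<Omega>" "connected \<Omega>" "\<Omega> \<noteq> {}"
    and rep_total: "\<exists>f. rep v f"
    and rep_on_domain: "rep v f \<Longrightarrow> (\<And>x. x \<in> \<Omega> \<Longrightarrow> f x = g x) \<Longrightarrow> rep v g"
    and rep_unique: "rep v f \<Longrightarrow> rep w f \<Longrightarrow> v = w"
    and rep_ae: "rep v f \<Longrightarrow> rep v g \<Longrightarrow> AE x in lebesgue_on \<Omega>. f x = g x"
    and rep_add: "rep v f \<Longrightarrow> rep w g \<Longrightarrow> rep (v + w) (\<lambda>x. f x + g x)"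
    and rep_scale: "rep v f \<Longrightarrow> rep (c *\<^sub>R v) (\<lambda>x. c * f x)"

definition coercive :: "('h::real_inner \<Rightarrow> 'h \<Rightarrow> real) \<Rightarrow> bool" where
  "coercive a \<longleftrightarrow> (\<exists>\<alpha>>0. \<forall>v. a v v \<ge> \<alpha> * (norm v)\<^sup>2)"

definition energy_norm :: "('h::real_inner \<Rightarrow> 'h \<Rightarrow> real) \<Rightarrow> 'h \<Rightarrow> real" where
  "energy_norm a v = sqrt (a v v)"

definition weak_residual ::
  "('h::real_inner \<Rightarrow> 'h \<Rightarrow> real) \<Rightarrow> ('h \<Rightarrow> real) \<Rightarrow> 'h \<Rightarrow> 'h \<Rightarrow> real" where
  "weak_residual a F w v = F v - a w v"

text \<open>The coordinates of a point, as a \<open>1 \<times> d\<close> row; \<^const>\<open>from_nat_into\<close> enumerates the index type.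
  The choice of enumeration only permutes the rows of the first weight matrix.\<close>
definition row_of :: "real ^ 'd \<Rightarrow> real mat" where
  "row_of x = mat 1 CARD('d) (\<lambda>(i, j). vec_nth x (from_nat_into UNIV j))"

text \<open>A list \<open>[(W\<^sub>1, b\<^sub>1), \<dots>, (W\<^sub>L, b\<^sub>L)]\<close> of layers is applied from left to right.\<close>
primrec hidden_layers ::
  "(real \<Rightarrow> real) \<Rightarrow> (real mat \<times> real mat) list \<Rightarrow> real mat \<Rightarrow> real mat" where
  "hidden_layers \<sigma> [] t = t"
| "hidden_layers \<sigma> (p # ps) t = hidden_layers \<sigma> ps (map_mat \<sigma> (t * fst p + snd p))"

definition network ::
  "(real \<Rightarrow> real) \<Rightarrow> (real mat \<times> real mat) list \<Rightarrow> real mat \<Rightarrow> real ^ 'd \<Rightarrow> real" where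
  "network \<sigma> ps c x = (hidden_layers \<sigma> ps (row_of x) * c) $$ (0, 0)"

definition network_shape ::
  "nat \<Rightarrow> nat list \<Rightarrow> (real mat \<times> real mat) list \<Rightarrow> real mat \<Rightarrow> bool" where
  "network_shape d ns ps c \<longleftrightarrow>
     length ps = length ns \<and>
     (\<forall>j < length ns. fst (ps ! j) \<in> carrier_mat ((d # ns) ! j) (ns ! j) \<and>
                      snd (ps ! j) \<in> carrier_mat 1 (ns ! j)) \<and>
     c \<in> carrier_mat (last (d # ns)) 1"

text \<open>The norm \<open>\<parallel>\<cdot>\<parallel>\<^sub>\<infinity>\<close> is the largest absolute value of an entry, for matrices as well as vectors.
  The inserted \<open>0\<close> only matters when there are no entries.\<close>
definition max_norm_mat :: "real mat \<Rightarrow> real" where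
  "max_norm_mat A = Max (insert 0 (abs ` elements_mat A))"

definition max_norm_vec :: "real Matrix.vec \<Rightarrow> real" where
  "max_norm_vec v = Max (insert 0 (abs ` vec_set v))"

text \<open>\<open>V\<^bsub>n,L\<^esub>\<^bsup>\<sigma>,C\<^esup>\<close>, where \<open>ns = [n\<^sub>1, \<dots>, n\<^sub>L]\<close> and thus \<open>L = length ns\<close>.\<close>
definition network_set ::
  "('h \<Rightarrow> (real ^ 'd \<Rightarrow> real) \<Rightarrow> bool) \<Rightarrow> (real \<Rightarrow> real) \<Rightarrow> nat list \<Rightarrow> real \<Rightarrow> 'h set" where
  "network_set rep \<sigma> ns C =
     {v. \<exists>ps c. network_shape CARD('d) ns ps c \<and>
           (\<Sum>p\<leftarrow>ps. max_norm_mat (fst p) + max_norm_mat (snd p)) + max_norm_mat c \<le> C \<and>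
           rep v (network \<sigma> ps c)}"

definition knowledge_fun ::
  "(real ^ 'd \<Rightarrow> real \<Rightarrow> real) \<Rightarrow> real Matrix.vec \<Rightarrow> real Matrix.vec \<Rightarrow> real ^ 'd \<Rightarrow> real" where
  "knowledge_fun \<Psi> lam d x = (\<Sum>j < dim_vec lam. vec_index d j * \<Psi> x (vec_index lam j))"

text \<open>\<open>V\<^sub>M\<^sup>\<Psi>(\<lambda>)\<close> and \<open>V\<^sub>M\<^bsup>\<Psi>,C\<^esup>(\<lambda>)\<close>, where \<open>M = dim_vec lam\<close>.\<close>
definition knowledge_space ::
  "('h \<Rightarrow> (real ^ 'd \<Rightarrow> real) \<Rightarrow> bool) \<Rightarrow> (real ^ 'd \<Rightarrow> real \<Rightarrow> real) \<Rightarrow> real Matrix.vec \<Rightarrow> 'h set" where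
  "knowledge_space rep \<Psi> lam =
     {v. \<exists>d \<in> carrier_vec (dim_vec lam). rep v (knowledge_fun \<Psi> lam d)}"

definition knowledge_set ::
  "('h \<Rightarrow> (real ^ 'd \<Rightarrow> real) \<Rightarrow> bool) \<Rightarrow> (real ^ 'd \<Rightarrow> real \<Rightarrow> real) \<Rightarrow> real Matrix.vec \<Rightarrow> real \<Rightarrow>
   'h set" where
  "knowledge_set rep \<Psi> lam C =
     {v. \<exists>d \<in> carrier_vec (dim_vec lam).
           max_norm_vec d + max_norm_vec lam \<le> C \<and> rep v (knowledge_fun \<Psi> lam d)}"

definition galerkin_space :: "'h::real_vector \<Rightarrow> 'h \<Rightarrow> (nat \<Rightarrow> 'h) \<Rightarrow> (nat \<Rightarrow> 'h) \<Rightarrow> nat \<Rightarrow> 'h set" where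
  "galerkin_space us0 up0 \<phi>s \<phi>p j = span ({us0, up0} \<union> \<phi>s ` {1..j} \<union> \<phi>p ` {1..j})"

end

(*
  Galerkin orthogonality makes u_j the best approximation of u from S_j in the energy norm. Both
  u_{j-1} and u_{j-1} + |||u - u_{j-1}||| phi_j^NN lie in S_j, and their errors are
  |||u - u_{j-1}||| and |||u - u_{j-1}||| |||phi_j - phi_j^NN|||; hence each step contracts the
  error by min {1, eps}. The a posteriori bounds follow from <r(w), v> = a(u - w, v) by the
  Cauchy-Schwarz inequality. That phi_j^NN maximizes the residual enters only through the
  normalization |||phi_j^NN||| = 1.
*)
theory Submission
  imports Defs
begin

text \<open>Such a form is an inner product whose norm is the energy norm. The locale collects the
  geometry that follows from this alone, with no mention of networks;
  \<open>bounded_bilinear\<close> supplies the linearity rules.\<close>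

locale symmetric_coercive_form = bounded_bilinear a
  for a :: "'h::real_inner \<Rightarrow> 'h \<Rightarrow> real" +
  assumes sym: "a v w = a w v"
    and coercive: "coercive a"
begin

lemma form_pos:
  assumes "v \<noteq> 0"
  shows "a v v > 0"
proof -
  obtain \<alpha> where "\<alpha> > 0" and "a v v \<ge> \<alpha> * (norm v)\<^sup>2"
    using coercive unfolding coercive_def by blast
  moreover have "\<alpha> * (norm v)\<^sup>2 > 0"
    using assms \<open>\<alpha> > 0\<close> by simp
  ultimately show ?thesis by linarith
qed

lemma form_nonneg: "a v v \<ge> 0"
  using form_pos[of v] by (cases "v = 0") (auto simp: zero_left)

lemma energy_norm_pos: "v \<noteq> 0 \<Longrightarrow> energy_norm a v > 0"
  by (simp add: energy_norm_def form_pos)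

lemma energy_norm_power2: "(energy_norm a v)\<^sup>2 = a v v"
  by (simp add: energy_norm_def form_nonneg)

lemma energy_norm_scaleR: "energy_norm a (c *\<^sub>R v) = \<bar>c\<bar> * energy_norm a v"
  by (simp add: energy_norm_def scaleR_left scaleR_right real_sqrt_mult flip: mult.assoc)

text \<open>Cauchy-Schwarz for the energy inner product. The case \<open>v = 0\<close> is separate
  because the proof cancels the factor \<open>a v v\<close>.\<close>

lemma form_power2_le: "(a v w)\<^sup>2 \<le> a v v * a w w"
proof (cases "v = 0")
  case False
  define p q r where "p = a v v" and "q = a v w" and "r = a w w"
  \<comment> \<open>The vector is \<open>p\<close> times the component of \<open>w\<close> that is
    \<open>a\<close>-orthogonal to \<open>v\<close>; scaling by \<open>p\<close> avoids
    division.\<close>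
  have "0 \<le> a (p *\<^sub>R w - q *\<^sub>R v) (p *\<^sub>R w - q *\<^sub>R v)"
    by (rule form_nonneg)
  also have "\<dots> = p * (p * r - q\<^sup>2)"
    by (simp add: diff_left diff_right scaleR_left scaleR_right sym[of w v]
        flip: p_def q_def r_def) (simp add: algebra_simps power2_eq_square)
  finally have "p * r - q\<^sup>2 \<ge> 0"
    using form_pos[OF False] by (simp add: p_def zero_le_mult_iff)
  then show ?thesis by (simp add: p_def q_def r_def)
qed (simp add: zero_left)

lemma form_le_energy_norm: "a v w \<le> energy_norm a v * energy_norm a w"
proof -
  have "\<bar>a v w\<bar> \<le> sqrt (a v v * a w w)"
    by (rule real_le_rsqrt) (simp add: form_power2_le)
  then show ?thesis by (simp add: energy_norm_def real_sqrt_mult)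
qed

text \<open>Pythagoras: \<open>u - w\<close> splits into \<open>u - p\<close> and
  \<open>p - w\<close>, and the latter lies in \<open>S\<close>, hence is
  \<open>a\<close>-orthogonal to the former.\<close>

lemma best_approximation:
  assumes "subspace S" and "p \<in> S" and "w \<in> S"
    and orth: "\<And>v. v \<in> S \<Longrightarrow> a (u - p) v = 0"
  shows "energy_norm a (u - p) \<le> energy_norm a (u - w)"
proof -
  have "a (u - p) (p - w) = 0"
    using assms by (simp add: subspace_diff)
  then have "a (u - w) (u - w) = a (u - p) (u - p) + a (p - w) (p - w)"
    by (simp add: diff_left diff_right sym[of p u] sym[of w u] sym[of p w])
  then show ?thesis
    using form_nonneg[of "p - w"] by (simp add: energy_norm_def)
qed

lemma galerkin_step:
  assumes S: "subspace S" "p \<in> S" "w \<in> S" "\<psi> \<in> S"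
    and orth: "\<And>v. v \<in> S \<Longrightarrow> a (u - p) v = 0"
    and "w \<noteq> u"
    and approx: "energy_norm a ((u - w) /\<^sub>R energy_norm a (u - w) - \<psi>) \<le> \<epsilon>"
  shows "energy_norm a (u - p) \<le> energy_norm a (u - w) * min 1 \<epsilon>"
proof -
  define E where "E = energy_norm a (u - w)"
  have "E > 0" using \<open>w \<noteq> u\<close> by (simp add: E_def energy_norm_pos)
  \<comment> \<open>The competitor \<open>w + E *\<^sub>R \<psi>\<close> would be \<open>u\<close>
    itself if \<psi> were the normalized error, so its own error is \<open>E\<close> times the
    defect of \<psi>.\<close>
  have "u - (w + E *\<^sub>R \<psi>) = E *\<^sub>R ((u - w) /\<^sub>R E - \<psi>)"
    using \<open>E > 0\<close> by (simp add: scaleR_diff_right)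
  then have "energy_norm a (u - (w + E *\<^sub>R \<psi>)) \<le> E * \<epsilon>"
    using \<open>E > 0\<close> approx by (simp add: energy_norm_scaleR flip: E_def)
  moreover have "energy_norm a (u - p) \<le> energy_norm a (u - (w + E *\<^sub>R \<psi>))"
    using S by (intro best_approximation orth) (simp_all add: subspace_add subspace_scale)
  moreover have "energy_norm a (u - p) \<le> E"
    unfolding E_def using S by (intro best_approximation orth)
  ultimately show ?thesis
    by (simp add: min_def flip: E_def)
qed

text \<open>The upper bound on \<open>a e \<psi>\<close> is Cauchy-Schwarz with a unit vector. For
  the lower one, \<psi> differs from the normalized error by \<delta>, and Cauchy-Schwarz bounds the
  loss \<open>a e \<delta>\<close> by \<epsilon> times the energy norm of \<open>e\<close>.\<close>

lemma error_estimate: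
  assumes "energy_norm a \<psi> = 1" and "e \<noteq> 0"
    and approx: "energy_norm a (e /\<^sub>R energy_norm a e - \<psi>) \<le> \<epsilon>"
  shows "a e \<psi> \<le> energy_norm a e" and "(1 - \<epsilon>) * energy_norm a e \<le> a e \<psi>"
proof -
  show "a e \<psi> \<le> energy_norm a e"
    using form_le_energy_norm[of e \<psi>] assms(1) by simp
  define E where "E = energy_norm a e"
  define \<delta> where "\<delta> = e /\<^sub>R E - \<psi>"
  have "E > 0" using \<open>e \<noteq> 0\<close> by (simp add: E_def energy_norm_pos)
  have "a e \<delta> \<le> E * energy_norm a \<delta>"
    unfolding E_def by (rule form_le_energy_norm)
  also have "\<dots> \<le> E * \<epsilon>"
    using approx \<open>E > 0\<close> by (simp add: \<delta>_def E_def)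
  finally have "a e \<delta> \<le> E * \<epsilon>" .
  \<comment> \<open>Testing \<open>e\<close> against its own normalization gives
    \<open>a e e / E = E\<close>.\<close>
  moreover have "a e \<delta> = E - a e \<psi>"
    using \<open>E > 0\<close> energy_norm_power2[of e]
    by (simp add: \<delta>_def diff_right scaleR_right power2_eq_square field_simps flip: E_def)
  ultimately show "(1 - \<epsilon>) * energy_norm a e \<le> a e \<psi>"
    by (simp add: algebra_simps flip: E_def)
qed

end

lemma subspace_galerkin_space: "subspace (galerkin_space us0 up0 \<phi>s \<phi>p j)"
  by (simp add: galerkin_space_def)

lemma galerkin_space_mono:
  "j \<le> k \<Longrightarrow> galerkin_space us0 up0 \<phi>s \<phi>p j \<subseteq> galerkin_space us0 up0 \<phi>s \<phi>p k"
  unfolding galerkin_space_def by (intro span_mono) auto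

lemma initial_mem_galerkin_space: "us0 + up0 \<in> galerkin_space us0 up0 \<phi>s \<phi>p j"
  unfolding galerkin_space_def by (intro span_add span_base) auto

lemma basis_mem_galerkin_space: "j \<ge> 1 \<Longrightarrow> \<phi>s j + \<phi>p j \<in> galerkin_space us0 up0 \<phi>s \<phi>p j"
  unfolding galerkin_space_def by (intro span_add span_base) auto

theorem corollary2p6:
  fixes \<Omega> :: "(real ^ 'd) set"
    and rep :: "'h::{real_inner, complete_space} \<Rightarrow> (real ^ 'd \<Rightarrow> real) \<Rightarrow> bool"
    and a :: "'h \<Rightarrow> 'h \<Rightarrow> real" and F :: "'h \<Rightarrow> real" and u :: 'h
    and \<sigma> :: "real \<Rightarrow> real" and n :: "nat \<Rightarrow> nat list" and C\<^sub>1 C\<^sub>2 :: "nat \<Rightarrow> real"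
    and \<Psi> :: "real ^ 'd \<Rightarrow> real \<Rightarrow> real" and M :: nat and lam :: "real Matrix.vec"
    and U \<phi>s \<phi>p :: "nat \<Rightarrow> 'h" and us0 up0 :: 'h
    and \<epsilon> :: real and i :: nat
  assumes X: "function_hilbert_space \<Omega> rep"
    and a: "bounded_bilinear a" "\<And>v w. a v w = a w v" "coercive a"
    and F: "bounded_linear F"
    and u: "\<And>v. a u v = F v"
    and lam: "lam \<in> carrier_vec M" "\<And>j. j < M \<Longrightarrow> \<exists>v. rep v (\<lambda>x. \<Psi> x (vec_index lam j))"
    and u0: "up0 \<in> knowledge_space rep \<Psi> lam" "U 0 = us0 + up0"
    and \<epsilon>: "\<epsilon> > 0" and i: "i \<ge> 1"
    and params: "\<And>j. j \<in> {1..i} \<Longrightarrow> length (n j) \<ge> 1 \<and> C\<^sub>1 j > 0 \<and> C\<^sub>2 j > 0"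
    and not_solved: "\<And>j. j \<in> {1..i} \<Longrightarrow> U (j - 1) \<noteq> u"
    and basis_parts: "\<And>j. j \<in> {1..i} \<Longrightarrow> \<phi>s j \<in> network_set rep \<sigma> (n j) (C\<^sub>1 j)"
      "\<And>j. j \<in> {1..i} \<Longrightarrow> \<phi>p j \<in> knowledge_set rep \<Psi> lam (C\<^sub>2 j)"
    and maximizer: "\<And>j. j \<in> {1..i} \<Longrightarrow>
      is_arg_max (weak_residual a F (U (j - 1)))
        (\<lambda>v. v \<in> network_set rep \<sigma> (n j) (C\<^sub>1 j) + knowledge_set rep \<Psi> lam (C\<^sub>2 j) \<and>
             energy_norm a v = 1)
        (\<phi>s j + \<phi>p j)"
    and galerkin: "\<And>j. j \<in> {1..i} \<Longrightarrow> U j \<in> galerkin_space us0 up0 \<phi>s \<phi>p j"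
      "\<And>j v. j \<in> {1..i} \<Longrightarrow> v \<in> galerkin_space us0 up0 \<phi>s \<phi>p j \<Longrightarrow> a (U j) v = F v"
    and approx: "\<And>j. j \<in> {1..i} \<Longrightarrow>
      energy_norm a ((u - U (j - 1)) /\<^sub>R energy_norm a (u - U (j - 1)) - (\<phi>s j + \<phi>p j)) \<le> \<epsilon>"
  shows "energy_norm a (u - U i) \<le> energy_norm a (u - U 0) * min 1 \<epsilon> ^ i \<and>
    (\<epsilon> < 1 \<longrightarrow>
      weak_residual a F (U (i - 1)) (\<phi>s i + \<phi>p i) \<le> energy_norm a (u - U (i - 1)) \<and>
      energy_norm a (u - U (i - 1))
        \<le> 1 / (1 - \<epsilon>) * weak_residual a F (U (i - 1)) (\<phi>s i + \<phi>p i))"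
proof -
  interpret symmetric_coercive_form a
    using a by (intro symmetric_coercive_form.intro symmetric_coercive_form_axioms.intro)
  \<comment> \<open>No Galerkin equation defines \<open>U 0\<close>, so \<open>j = 1\<close> is
    treated apart: both summands of \<open>U 0\<close> are among the generators. For larger
    \<open>j\<close> the spaces are nested.\<close>
  have previous: "U (j - 1) \<in> galerkin_space us0 up0 \<phi>s \<phi>p j" if "j \<in> {1..i}" for j
  proof (cases "j = 1")
    case True
    then show ?thesis by (simp add: u0 initial_mem_galerkin_space)
  next
    case False
    then have "U (j - 1) \<in> galerkin_space us0 up0 \<phi>s \<phi>p (j - 1)"
      using that by (intro galerkin) auto
    then show ?thesis by (rule subsetD[OF galerkin_space_mono, rotated]) simp
  qed
  have step: "energy_norm a (u - U j) \<le> energy_norm a (u - U (j - 1)) * min 1 \<epsilon>"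
    if "j \<in> {1..i}" for j
  proof (rule galerkin_step[OF subspace_galerkin_space galerkin(1) previous])
    show "a (u - U j) v = 0" if "v \<in> galerkin_space us0 up0 \<phi>s \<phi>p j" for v
      using galerkin(2)[OF \<open>j \<in> {1..i}\<close> that] by (simp add: diff_left u)
  qed (use that not_solved[OF that] approx[OF that] in \<open>auto intro: basis_mem_galerkin_space\<close>)
  \<comment> \<open>The step estimate is available only for indices up to \<open>i\<close>, so the
    induction carries the bound \<open>j \<le> i\<close>.\<close>
  have "energy_norm a (u - U j) \<le> energy_norm a (u - U 0) * min 1 \<epsilon> ^ j" if "j \<le> i" for j
    using that
  proof (induction j)
    case (Suc j)
    have "energy_norm a (u - U (Suc j)) \<le> energy_norm a (u - U j) * min 1 \<epsilon>"
      using step[of "Suc j"] Suc.prems by simp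
    \<comment> \<open>Positivity of \<epsilon> makes the factor \<open>min 1 \<epsilon>\<close>
      nonnegative, as monotonicity requires.\<close>
    also have "\<dots> \<le> (energy_norm a (u - U 0) * min 1 \<epsilon> ^ j) * min 1 \<epsilon>"
      using Suc \<epsilon> by (intro mult_right_mono) auto
    finally show ?case by (simp add: mult_ac)
  qed simp
  \<comment> \<open>Since \<open>u\<close> solves the variational problem, the residual is the error
    tested in the energy inner product, to which \<open>error_estimate\<close> applies.\<close>
  moreover have "weak_residual a F (U (i - 1)) v = a (u - U (i - 1)) v" for v
    by (simp add: weak_residual_def diff_left u)
  moreover have "energy_norm a (\<phi>s i + \<phi>p i) = 1"
    using maximizer[of i] i by (simp add: is_arg_max_def)
  ultimately show ?thesis
    using error_estimate[of "\<phi>s i + \<phi>p i" "u - U (i - 1)" \<epsilon>] not_solved[of i] approx[of i] i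
    by (simp add: field_simps)
qed

end
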